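(* Let $\mathbb{F}$ be a field. Any PB-companion ULH matrix (whose variables $x_1,\ldots,x_n$ are placed according to the order $\prec$) belongs to $\widetilde{\mathcal{B}}$. Moreover, if $A\in\widetilde{\mathcal{B}}$ then $A$ is PB-companion if and only if $\mathfrak{M}_A$ is nonsingular.
   Context: $\mathbb{F}$ is a field and $x_1,\ldots,x_n$ are variables (independent indeterminates). $\mathbb{F}_n[\lambda]$ is the $(n+1)$-dimensional vector space of polynomials in $\lambda$ over $\mathbb{F}$ of degree at most $n$. A matrix $A$ of order $n$ is PB-companion (companion with respect to a polynomial basis) if: $n^2-n$ of its entries are constants of $\mathbb{F}$; the $n$ remaining entries are the variables $x_1,\ldots,x_n$ (each appearing once); and $\det(\lambda I_n-A)=p_n(\lambda)-x_1p_{n-1}(\lambda)-\cdots-x_{n-1}p_1(\lambda)-x_np_0(\lambda)$ where $\{p_n(\lambda),\ldots,p_1(\lambda),p_0(\lambda)\}$ is a basis of $\mathbb{F}_n[\lambda]$. A square matrix is unit lower Hessenberg (ULH) if all superdiagonal entries equal $1$ and all entries above the superdiagonal are $0$. The total order $\prec$ on $\mathbb{Z}\times\mathbb{Z}$ is: $(i,j)\prec(i',j')$ iff $i-j<i'-j'$, or $i-j=i'-j'$ and $i<i'$. The variables are placed according to $\prec$ if, with $(i_k,j_k)$ the position of $x_k$, one has $(i_1,j_1)\prec\cdots\prec(i_n,j_n)$. $B_{(i_1,j_1),\ldots,(i_n,j_n)}$, defined when $(i_1,j_1)\prec\cdots\prec(i_n,j_n)$, all $i_k,j_k\in\{1,\ldots,n\}$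 and $\max\{j_1,\ldots,j_n\}\le\min\{i_1,\ldots,i_n\}$, is the ULH matrix of order $n$ whose $(i_k,j_k)$ entry is $x_k$ for $k=1,\ldots,n$ and all of whose other entries on or below the main diagonal are $0$. $\mathcal{B}$ is the set of all such matrices (of any order $n\ge1$). A ULH superpattern of a ULH matrix $M$ is a matrix obtained from $M$ by changing some (possibly none) of the zero entries of $M$ on or below the main diagonal to nonzero constants of $\mathbb{F}$. $\widetilde{\mathcal{B}}$ is the set of all ULH superpatterns of all matrices of $\mathcal{B}$. For every $A\in\widetilde{\mathcal{B}}$ of order $n$ the characteristic polynomial can be written (uniquely) as $\det(\lambda I_n-A)=p_n(\lambda)-x_1p_{n-1}(\lambda)-\cdots-x_np_0(\lambda)$ with $p_0,\ldots,p_n\in\mathbb{F}_n[\lambda]$. $\mathfrak{M}_A$ is the constant matrix $[p_{ij}]_{i,j=0}^n$ of order $n+1$ where $p_i(\lambda)=p_{i0}+p_{i1}\lambda+\cdots+p_{in}\lambda^n$ for $i=0,1,\ldots,n$. *)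

theory Defs
  imports "HOL-Library.Poly_Mapping" "Jordan_Normal_Form.Char_Poly"
begin

text \<open>
  Matrix entries live in the polynomial ring over the field in indeterminates indexed by
  \<^typ>\<open>nat\<close>: a monomial is a finitely supported map from variables to exponents, a polynomial is
  a finitely supported map from monomials to coefficients.
\<close>

type_synonym 'a mpol = "(nat \<Rightarrow>\<^sub>0 nat) \<Rightarrow>\<^sub>0 'a"

definition Const :: "'a::comm_ring_1 \<Rightarrow> 'a mpol" where
  "Const c = Poly_Mapping.single 0 c"

definition X :: "nat \<Rightarrow> 'a::comm_ring_1 mpol" where
  "X k = Poly_Mapping.single (Poly_Mapping.single k 1) 1"

text \<open>Matrix positions are counted from 1, whereas the library counts from 0.\<close>

definition entry :: "'b mat \<Rightarrow> nat \<Rightarrow> nat \<Rightarrow> 'b" where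
  "entry A i j = A $$ (i - 1, j - 1)"

definition poly_space :: "nat \<Rightarrow> 'a::field poly set" where
  "poly_space n = {p. degree p \<le> n}"

text \<open>
  The constants of locale \<^locale>\<open>Modules.module\<close> and \<^const>\<open>Polynomial.smult\<close> are qualified because
  HOL-Algebra uses the same names.
\<close>

definition is_poly_basis :: "nat \<Rightarrow> 'a::field poly set \<Rightarrow> bool" where
  "is_poly_basis n S \<longleftrightarrow>
     \<not> Modules.module.dependent Polynomial.smult S \<and> Modules.module.span Polynomial.smult S = poly_space n"

definition char_poly_form :: "'a::field mpol mat \<Rightarrow> (nat \<Rightarrow> 'a poly) \<Rightarrow> bool" where
  "char_poly_form A p \<longleftrightarrow> (let n = dim_row A in
     char_poly A = map_poly Const (p n)
       - (\<Sum>k=1..n. Polynomial.smult (X k) (map_poly Const (p (n - k)))))"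

definition pb_companion :: "'a::field mpol mat \<Rightarrow> bool" where
  "pb_companion A \<longleftrightarrow> (let n = dim_row A in
     square_mat A \<and>
     (\<forall>k\<in>{1..n}. \<exists>!(i, j). i \<in> {1..n} \<and> j \<in> {1..n} \<and> entry A i j = X k) \<and>
     (\<forall>i\<in>{1..n}. \<forall>j\<in>{1..n}. entry A i j \<in> range Const \<union> X ` {1..n}) \<and>
     (\<exists>p. is_poly_basis n (p ` {0..n}) \<and> char_poly_form A p))"

definition ulh :: "'b::{zero,one} mat \<Rightarrow> bool" where
  "ulh A \<longleftrightarrow> (let n = dim_row A in
     square_mat A \<and>
     (\<forall>i\<in>{1..n}. \<forall>j\<in>{1..n}.
        (j = i + 1 \<longrightarrow> entry A i j = 1) \<and> (i + 1 < j \<longrightarrow> entry A i j = 0)))"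

definition prec :: "int \<times> int \<Rightarrow> int \<times> int \<Rightarrow> bool" (infix \<open>\<prec>\<close> 50) where
  "u \<prec> v \<longleftrightarrow> fst u - snd u < fst v - snd v
     \<or> (fst u - snd u = fst v - snd v \<and> fst u < fst v)"

definition prec_chain :: "nat \<Rightarrow> (nat \<Rightarrow> nat) \<Rightarrow> (nat \<Rightarrow> nat) \<Rightarrow> bool" where
  "prec_chain n r c \<longleftrightarrow>
     (\<forall>k\<in>{1..<n}. (int (r k), int (c k)) \<prec> (int (r (k + 1)), int (c (k + 1))))"

definition vars_at :: "'a::field mpol mat \<Rightarrow> (nat \<Rightarrow> nat) \<Rightarrow> (nat \<Rightarrow> nat) \<Rightarrow> bool" where
  "vars_at A r c \<longleftrightarrow> (let n = dim_row A in
     \<forall>k\<in>{1..n}. r k \<in> {1..n} \<and> c k \<in> {1..n} \<and> entry A (r k) (c k) = X k)"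

definition vars_ordered :: "'a::field mpol mat \<Rightarrow> bool" where
  "vars_ordered A \<longleftrightarrow> (\<exists>r c. vars_at A r c \<and> prec_chain (dim_row A) r c)"

definition B_set :: "'a::field mpol mat set" where
  "B_set = {M. \<exists>n\<ge>1. \<exists>r c. M \<in> carrier_mat n n \<and> ulh M \<and>
     vars_at M r c \<and> prec_chain n r c \<and> Max (c ` {1..n}) \<le> Min (r ` {1..n}) \<and>
     (\<forall>i\<in>{1..n}. \<forall>j\<in>{1..n}. j \<le> i \<and> (\<forall>k\<in>{1..n}. (i, j) \<noteq> (r k, c k)) \<longrightarrow> entry M i j = 0)}"

definition ulh_superpattern :: "'a::field mpol mat \<Rightarrow> 'a mpol mat \<Rightarrow> bool" where
  "ulh_superpattern A M \<longleftrightarrow> (let n = dim_row M in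
     ulh M \<and> A \<in> carrier_mat n n \<and>
     (\<forall>i\<in>{1..n}. \<forall>j\<in>{1..n}. entry A i j = entry M i j \<or>
        (j \<le> i \<and> entry M i j = 0 \<and> (\<exists>c. c \<noteq> 0 \<and> entry A i j = Const c))))"

definition B_tilde :: "'a::field mpol mat set" where
  "B_tilde = {A. \<exists>M\<in>B_set. ulh_superpattern A M}"

text \<open>
  The coefficient matrix is only meaningful for members of \<^const>\<open>B_tilde\<close>: their characteristic
  polynomial is affine in the variables, and the polynomials \<open>p 0, \<dots>, p n\<close> are then determined by
  comparing coefficients. The description ranges over the matrix because \<open>p\<close> itself is
  unconstrained beyond index \<open>n\<close>.
\<close>

definition coeff_matrix :: "'a::field mpol mat \<Rightarrow> 'a mat" where
  "coeff_matrix A = (let n = dim_row A in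
     THE M. \<exists>p. (\<forall>i\<le>n. p i \<in> poly_space n) \<and> char_poly_form A p \<and>
       M = mat (n + 1) (n + 1) (\<lambda>(i, j). Polynomial.coeff (p i) j))"

end

theory Submission
  imports Defs
begin

text \<open>
  The determinant of a Hessenberg matrix \<open>h\<close> with \<open>-1\<close> on the superdiagonal satisfies a linear
  recursion: the leading principal minors \<open>D 0 = 1, D 1, D 2, \<dots>\<close> obey
  \<open>D (m + 1) = (\<Sum>a\<le>m. h m a * D a)\<close> (\<open>det_hessenberg\<close>). Unrolled, it is a sum over all ways to cut
  \<open>{1..n}\<close> into consecutive intervals, an interval from \<open>j\<close> to \<open>i\<close> contributing the entry at
  \<open>(i, j)\<close>. A variable placed at \<open>(r k, c k)\<close> thus stands for the interval from \<open>c k\<close> to \<open>r k\<close>,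
  and two variables can occur in a common product only if their intervals are disjoint. The
  condition \<open>max c \<le> min r\<close> that defines \<^const>\<open>B_tilde\<close> says that any two of these intervals
  meet, so that the characteristic polynomial is affine in the variables.

  If the condition fails, say \<open>r l < c k\<close>, then the coefficient of \<open>X k * X l\<close> in the
  characteristic polynomial, with the other variables set to \<open>0\<close>, is a product of monic
  characteristic polynomials, hence not zero, and the characteristic polynomial is not affine.
  The coefficient is isolated as a second difference between the values at variables in
  \<open>{0, 1}\<close>, and its monicity follows from the recursion (\<open>hess_second_difference_nonzero\<close>,
  \<open>var_intervals_overlap\<close>). This proves the first part.

  If the condition holds, an induction along the recursion shows that the characteristic
  polynomial is affine (\<open>hess_affine\<close>, \<open>char_poly_form_exists\<close>). Comparing coefficients makes
  \<open>p 0, \<dots>, p n\<close> unique, so that \<^const>\<open>coeff_matrix\<close> has their coefficients as its rows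
  (\<open>coeff_matrix_eq\<close>). Being a basis is then the invertibility of this matrix
  (\<open>is_poly_basis_iff_invertible\<close>).
\<close>

section \<open>Determinants of Hessenberg matrices\<close>

text \<open>
  The \<open>m\<close>-th leading principal minor of the matrix with entries \<open>h i j\<close> for \<open>j \<le> i\<close>, with \<open>-1\<close>
  on the superdiagonal and \<open>0\<close> above it. Rows and columns are counted from \<open>0\<close>.
\<close>

fun hess :: "(nat \<Rightarrow> nat \<Rightarrow> 'b::comm_ring_1) \<Rightarrow> nat \<Rightarrow> 'b" where
  "hess h 0 = 1"
| "hess h (Suc m) = (\<Sum>a\<le>m. h m a * hess h a)"

lemma hess_cong:
  assumes "\<And>i j. j \<le> i \<Longrightarrow> i < n \<Longrightarrow> h i j = h' i j"
  shows "hess h n = hess h' n"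
proof -
  have "m \<le> n \<Longrightarrow> hess h m = hess h' m" for m
  proof (induction m rule: less_induct)
    case (less m)
    then show ?case using assms by (cases m) auto
  qed
  then show ?thesis by simp
qed

text \<open>
  The vector \<open>(D 0, \<dots>, D (n - 1))\<close> of leading minors is annihilated by all rows of \<open>H\<close> but the
  last, where it gives \<open>D n\<close>: this is the recursion, the term \<open>- D (i + 1)\<close> coming from the
  superdiagonal. Since \<open>D 0 = 1\<close>, putting it into column \<open>0\<close> of the identity matrix gives a
  unimodular \<open>V\<close>, and \<open>H * V\<close> has a column \<open>0\<close> with the single entry \<open>D n\<close>.
\<close>

lemma det_hessenberg:
  fixes H :: "'b::comm_ring_1 mat"
  assumes H: "H \<in> carrier_mat n n"
    and super: "\<And>i. i + 1 < n \<Longrightarrow> H $$ (i, i + 1) = -1"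
    and above: "\<And>i j. i + 1 < j \<Longrightarrow> j < n \<Longrightarrow> H $$ (i, j) = 0"
  shows "det H = hess (\<lambda>i j. H $$ (i, j)) n"
proof (cases n)
  case 0
  then show ?thesis using H by simp
next
  case (Suc m)
  define D where "D = hess (\<lambda>i j. H $$ (i, j))"
  define V where "V = mat n n (\<lambda>(i, j). if j = 0 then D i else if i = j then 1 else 0)"
  define W where "W = H * V"
  have V: "V \<in> carrier_mat n n" by (simp add: V_def)
  have W: "W \<in> carrier_mat n n" using H V by (simp add: W_def)
  have row: "(\<Sum>k<n. H $$ (i, k) * D k) = (if i = m then D n else 0)" if "i < n" for i
  proof (cases "i = m")
    case True
    then show ?thesis by (simp add: D_def Suc lessThan_Suc_atMost)
  next
    case False
    then have i: "i + 1 < n" using that Suc by simp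
    have "(\<Sum>k<n. H $$ (i, k) * D k) = (\<Sum>k\<le>i + 1. H $$ (i, k) * D k)"
      using i above by (intro sum.mono_neutral_right) auto
    also have "\<dots> = (\<Sum>k\<le>i. H $$ (i, k) * D k) - D (Suc i)"
      using super[OF i] by simp
    also have "\<dots> = 0" by (simp add: D_def)
    finally show ?thesis using False by simp
  qed
  have W0: "W $$ (i, 0) = (if i = m then D n else 0)" if "i < n" for i
    using that H row[OF that]
    by (simp add: W_def V_def Suc scalar_prod_def atLeast0LessThan)
  have Wj: "W $$ (i, Suc j) = H $$ (i, Suc j)" if "i < n" "Suc j < n" for i j
  proof -
    have "W $$ (i, Suc j) = (\<Sum>k = 0..<n. H $$ (i, k) * (if k = Suc j then 1 else 0))"
      using that H by (auto simp: W_def V_def scalar_prod_def intro!: sum.cong)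
    then show ?thesis using that by (simp add: if_distrib sum.delta cong: if_cong)
  qed
  have detV: "det V = 1"
  proof (subst det_lower_triangular[of n])
    show "prod_list (diag_mat V) = 1"
      unfolding prod_list_diag_prod
      by (rule prod.neutral) (auto simp: V_def D_def)
  qed (auto simp: V_def)
  \<comment> \<open>Deleting the last row and column 0 moves the superdiagonal of \<open>H\<close> to the diagonal.\<close>
  have minor: "mat_delete W m 0 \<in> carrier_mat m m"
    using mat_delete_carrier[OF W] Suc by simp
  have ent: "mat_delete W m 0 $$ (i, j) = H $$ (i, Suc j)" if "i < m" "j < m" for i j
    using that Wj[of i j] W Suc by (simp add: mat_delete_def)
  have "det (mat_delete W m 0) = (-1) ^ m"
  proof (subst det_lower_triangular[of m])
    show "mat_delete W m 0 $$ (i, j) = 0" if "i < j" "j < m" for i j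
      using that ent above Suc by simp
    show "prod_list (diag_mat (mat_delete W m 0)) = (-1) ^ m"
      unfolding prod_list_diag_prod carrier_matD(1)[OF minor] using ent super Suc by simp
  qed (rule minor)
  then have cof: "cofactor W m 0 = 1"
    by (simp add: cofactor_def flip: power_mult_distrib)
  have "det W = (\<Sum>i<n. W $$ (i, 0) * cofactor W i 0)"
    using laplace_expansion_column[OF W, of 0] Suc by simp
  also have "\<dots> = (\<Sum>i<n. if i = m then D n else 0)"
    by (rule sum.cong) (auto simp: W0 cof)
  also have "\<dots> = D n" using Suc by simp
  finally show ?thesis
    using det_mult[OF H V] detV by (simp add: W_def D_def)
qed

definition char_entry :: "'b::comm_ring_1 mat \<Rightarrow> nat \<Rightarrow> nat \<Rightarrow> 'b poly" where
  "char_entry A i j = (if i = j then [:0, 1:] else 0) - [:A $$ (i, j):]"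

lemma char_poly_ulh:
  assumes A: "A \<in> carrier_mat n n" and "ulh A"
  shows "char_poly A = hess (char_entry A) n"
proof -
  let ?C = "char_poly_matrix A"
  have C: "?C \<in> carrier_mat n n" using A by simp
  have ent: "?C $$ (i, j) = char_entry A i j" if "i < n" "j < n" for i j
    using that A by (simp add: char_poly_matrix_def char_entry_def)
  have ulhD: "(j = i + 1 \<longrightarrow> A $$ (i, j) = 1) \<and> (i + 1 < j \<longrightarrow> A $$ (i, j) = 0)"
    if "i < n" "j < n" for i j
  proof -
    have mem: "i + 1 \<in> {1..n}" "j + 1 \<in> {1..n}" using that by auto
    have "\<forall>i\<in>{1..n}. \<forall>j\<in>{1..n}.
        (j = i + 1 \<longrightarrow> entry A i j = 1) \<and> (i + 1 < j \<longrightarrow> entry A i j = 0)"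
      using assms unfolding ulh_def Let_def by simp
    from this[rule_format, OF mem] show ?thesis by (simp add: entry_def)
  qed
  have u1: "A $$ (i, i + 1) = 1" if "i + 1 < n" for i
    using that ulhD by simp
  have u0: "A $$ (i, j) = 0" if "i + 1 < j" "j < n" for i j
    using that ulhD by simp
  have "det ?C = hess (\<lambda>i j. ?C $$ (i, j)) n"
    using u1 u0 by (intro det_hessenberg[OF C]) (auto simp: ent char_entry_def one_pCons)
  also have "\<dots> = hess (char_entry A) n"
    by (rule hess_cong) (simp add: ent)
  finally show ?thesis by (simp add: char_poly_def)
qed

section \<open>Second differences of Hessenberg determinants\<close>

text \<open>
  If \<open>h\<close> has linear monic polynomials on the diagonal and constants below it, then the term
  \<open>h m m * u m\<close> dominates the recursion: a solution that starts monic at \<open>s\<close> stays monic and gains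
  one degree in each step. The sequence of minors is the case \<open>s = 0\<close>; the differences of
  perturbed minors start later.
\<close>

lemma hessenberg_growth:
  fixes h :: "nat \<Rightarrow> nat \<Rightarrow> 'a::field poly" and u :: "nat \<Rightarrow> 'a poly"
  assumes diag: "\<And>m. m < n \<Longrightarrow> degree (h m m) = 1 \<and> coeff (h m m) 1 = 1"
    and below: "\<And>m a. a < m \<Longrightarrow> m < n \<Longrightarrow> degree (h m a) = 0"
    and start: "\<And>a. a < s \<Longrightarrow> u a = 0" "lead_coeff (u s) = 1"
    and step: "\<And>m. s \<le> m \<Longrightarrow> m < n \<Longrightarrow> u (Suc m) = (\<Sum>a\<le>m. h m a * u a)"
    and "s \<le> m" "m \<le> n"
  shows "lead_coeff (u m) = 1 \<and> degree (u m) = degree (u s) + (m - s)"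
  using assms(6,7)
proof (induction m rule: less_induct)
  case (less m)
  show ?case
  proof (cases "m = s")
    case True
    then show ?thesis using start by simp
  next
    case False
    then obtain k where m: "m = Suc k" and k: "s \<le> k" "k < n"
      using less.prems by (cases m) auto
    define R where "R = (\<Sum>a<k. h k a * u a)"
    have IH: "lead_coeff (u k) = 1" "degree (u k) = degree (u s) + (k - s)"
      using less.IH[of k] m k by auto
    have "degree (h k a * u a) \<le> degree (u k)" if "a < k" for a
    proof (cases "a < s")
      case True
      then show ?thesis using start by simp
    next
      case False
      then have "degree (u a) \<le> degree (u k)"
        using less.IH[of a] m k that IH by auto
      then show ?thesis
        using degree_mult_le[of "h k a" "u a"] below[OF that k(2)] by simp
    qed
    then have R: "degree R \<le> degree (u k)"
      unfolding R_def by (intro degree_sum_le) auto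
    have nz: "h k k \<noteq> 0" "u k \<noteq> 0" using diag[OF k(2)] IH by auto
    have deg: "degree (h k k * u k) = Suc (degree (u k))"
      using degree_mult_eq[OF nz] diag[OF k(2)] by simp
    have lc: "lead_coeff (h k k * u k) = 1"
      using diag[OF k(2)] IH by (simp add: lead_coeff_mult)
    have u: "u m = R + h k k * u k"
      using step[OF k] m by (simp add: R_def lessThan_Suc_atMost[symmetric])
    have lt: "degree R < degree (h k k * u k)" using R deg by simp
    have "degree (u m) = Suc (degree (u k))"
      unfolding u using degree_add_eq_right[OF lt] deg by simp
    moreover have "lead_coeff (u m) = 1"
      unfolding u using lead_coeff_add_le[OF lt] lc by simp
    ultimately show ?thesis using IH k m by simp
  qed
qed

definition decr_entry :: "(nat \<Rightarrow> nat \<Rightarrow> 'b::comm_ring_1) \<Rightarrow> nat \<Rightarrow> nat \<Rightarrow> nat \<Rightarrow> nat \<Rightarrow> 'b" where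
  "decr_entry h i j = (\<lambda>a b. h a b - (if a = i \<and> b = j then 1 else 0))"

lemma hess_decr_entry_Suc:
  assumes "j \<le> i"
  shows "hess (decr_entry h i j) (Suc m) =
    (\<Sum>a\<le>m. h m a * hess (decr_entry h i j) a) - (if m = i then hess (decr_entry h i j) j else 0)"
proof -
  have "(\<Sum>a\<le>m. (if m = i \<and> a = j then 1 else 0) * hess (decr_entry h i j) a)
      = (\<Sum>a\<le>m. if a = j then (if m = i then hess (decr_entry h i j) j else 0) else 0)"
    by (rule sum.cong) auto
  then show ?thesis
    using assms by (simp add: decr_entry_def left_diff_distrib sum_subtractf)
qed

lemma hess_decr_entry_le:
  assumes "m \<le> i" shows "hess (decr_entry h i j) m = hess h m"
  using assms by (intro hess_cong) (simp add: decr_entry_def)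

text \<open>
  The first difference \<open>e\<close> vanishes up to index \<open>i1\<close>, and there the recursion for it is fed with
  the monic minor of order \<open>j1\<close>. The second difference \<open>g\<close> vanishes up to \<open>i2\<close>, and is there fed
  with \<open>e j2\<close>. Because \<open>i1 < j2\<close>, the sequence \<open>e\<close> is already monic at \<open>j2\<close>; if the intervals
  overlapped, \<open>e j2\<close> would be \<open>0\<close>.
\<close>

lemma hess_second_difference_nonzero:
  fixes h :: "nat \<Rightarrow> nat \<Rightarrow> 'a::field poly"
  assumes diag: "\<And>m. m < n \<Longrightarrow> degree (h m m) = 1 \<and> coeff (h m m) 1 = 1"
    and below: "\<And>m a. a < m \<Longrightarrow> m < n \<Longrightarrow> degree (h m a) = 0"
    and pos: "j1 \<le> i1" "i1 < j2" "j2 \<le> i2" "i2 < n"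
  shows "hess h n - hess (decr_entry h i1 j1) n - hess (decr_entry h i2 j2) n
    + hess (decr_entry (decr_entry h i1 j1) i2 j2) n \<noteq> 0"
proof -
  define h1 where "h1 = decr_entry h i1 j1"
  define h2 where "h2 = decr_entry h i2 j2"
  define h12 where "h12 = decr_entry h1 i2 j2"
  define e where "e m = hess h m - hess h1 m" for m
  define g where "g m = hess h m - hess h1 m - hess h2 m + hess h12 m" for m
  note growth = hessenberg_growth[where h = h and n = n, OF diag below]
  have d: "lead_coeff (hess h m) = 1" if "m \<le> n" for m
  proof -
    have "lead_coeff (hess h m) = 1 \<and> degree (hess h m) = degree (hess h 0) + (m - 0)"
      by (rule growth) (use that in auto)
    then show ?thesis by blast
  qed
  have e0: "e m = 0" if "m \<le> i1" for m
    using that by (simp add: e_def h1_def hess_decr_entry_le)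
  have e_Suc: "e (Suc m) = (\<Sum>a\<le>m. h m a * e a) + (if m = i1 then hess h j1 else 0)" for m
    using pos hess_decr_entry_Suc[OF pos(1), of h m] hess_decr_entry_le[OF pos(1), of h j1]
    by (simp add: e_def h1_def right_diff_distrib sum_subtractf)
  have e1: "e (Suc i1) = hess h j1"
    by (simp add: e_Suc e0)
  have e: "lead_coeff (e m) = 1" if "i1 < m" "m \<le> n" for m
  proof -
    have "lead_coeff (e m) = 1 \<and> degree (e m) = degree (e (Suc i1)) + (m - Suc i1)"
      by (rule growth) (use that pos d in \<open>auto simp: e0 e_Suc e1 simp del: hess.simps\<close>)
    then show ?thesis by blast
  qed
  have h12: "h12 = decr_entry h2 i1 j1"
    by (auto simp: h12_def h1_def h2_def decr_entry_def fun_eq_iff)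
  have g0: "g m = 0" if "m \<le> i2" for m
    using that by (simp add: g_def h12_def h2_def hess_decr_entry_le)
  have h12_Suc: "hess h12 (Suc m) = (\<Sum>a\<le>m. h m a * hess h12 a)
      - (if m = i1 then hess h12 j1 else 0) - (if m = i2 then hess h12 j2 else 0)" for m
  proof -
    have "hess h12 (Suc m) = (\<Sum>a\<le>m. h1 m a * hess h12 a) - (if m = i2 then hess h12 j2 else 0)"
      unfolding h12_def by (rule hess_decr_entry_Suc[OF pos(3)])
    moreover have "(\<Sum>a\<le>m. h1 m a * hess h12 a) = (\<Sum>a\<le>m. h m a * hess h12 a)
        - (\<Sum>a\<le>m. if a = j1 then (if m = i1 then hess h12 j1 else 0) else 0)"
      unfolding sum_subtractf[symmetric]
      by (rule sum.cong) (auto simp: h1_def decr_entry_def left_diff_distrib)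
    ultimately show ?thesis using pos by simp
  qed
  have g_Suc: "g (Suc m) = (\<Sum>a\<le>m. h m a * g a) + (if m = i2 then e j2 else 0)" 
    if "i2 \<le> m" for m
  proof -
    have "hess h2 j2 = hess h j2" "hess h12 j2 = hess h1 j2"
      using pos by (simp_all add: h2_def h12_def hess_decr_entry_le)
    moreover have "hess h1 (Suc m) = (\<Sum>a\<le>m. h m a * hess h1 a)"
      using that pos by (simp add: h1_def hess_decr_entry_Suc del: hess.simps)
    moreover have "hess h2 (Suc m) =
        (\<Sum>a\<le>m. h m a * hess h2 a) - (if m = i2 then hess h2 j2 else 0)"
      unfolding h2_def by (rule hess_decr_entry_Suc[OF pos(3)])
    ultimately show ?thesis
      using that pos unfolding g_def h12_Suc e_def hess.simps(2)[of h m]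
      by (simp add: distrib_left right_diff_distrib sum_subtractf sum.distrib)
  qed
  have g1: "g (Suc i2) = e j2"
    by (simp add: g_Suc g0)
  have "lead_coeff (g n) = 1 \<and> degree (g n) = degree (g (Suc i2)) + (n - Suc i2)"
  proof (rule growth)
    show "lead_coeff (g (Suc i2)) = 1" using e[of j2] pos by (simp only: g1)
  qed (use pos in \<open>simp_all add: g0 g_Suc\<close>)
  then have "g n \<noteq> 0" by (metis coeff_0 zero_neq_one)
  then show ?thesis by (simp add: g_def h1_def h2_def h12_def)
qed

section \<open>Evaluation of the indeterminates at 0 and 1\<close>

lemma comm_ring_hom_Const: "comm_ring_hom (Const :: 'a::comm_ring_1 \<Rightarrow> 'a mpol)"
  by unfold_locales (simp_all add: Const_def single_add mult_single)

interpretation Const_hom: comm_ring_hom "Const :: 'a::comm_ring_1 \<Rightarrow> 'a mpol"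
  by (rule comm_ring_hom_Const)

interpretation Const_poly_hom: map_poly_comm_ring_hom "Const :: 'a::comm_ring_1 \<Rightarrow> 'a mpol" ..

lemma lookup_Const: "Poly_Mapping.lookup (Const c) m = (if m = 0 then c else 0)"
  by (simp add: Const_def lookup_single when_def)

lemma X_mult_Const: "X k * Const c = Poly_Mapping.single (Poly_Mapping.single k 1) c"
  by (simp add: X_def Const_def mult_single)

lemma single_var_eq_iff:
  "(Poly_Mapping.single k 1 :: nat \<Rightarrow>\<^sub>0 nat) = Poly_Mapping.single l 1 \<longleftrightarrow> k = l"
proof
  assume "(Poly_Mapping.single k 1 :: nat \<Rightarrow>\<^sub>0 nat) = Poly_Mapping.single l 1"
  then have "Poly_Mapping.lookup (Poly_Mapping.single k 1 :: nat \<Rightarrow>\<^sub>0 nat) k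
    = Poly_Mapping.lookup (Poly_Mapping.single l 1) k" by simp
  then show "k = l" by (auto simp: lookup_single when_def split: if_splits)
qed simp

lemma single_var_nonzero: "(Poly_Mapping.single k 1 :: nat \<Rightarrow>\<^sub>0 nat) \<noteq> 0"
proof
  assume "(Poly_Mapping.single k 1 :: nat \<Rightarrow>\<^sub>0 nat) = 0"
  then have "Poly_Mapping.lookup (Poly_Mapping.single k 1 :: nat \<Rightarrow>\<^sub>0 nat) k = 0" by simp
  then show False by (simp add: lookup_single)
qed

lemma lookup_X:
  "Poly_Mapping.lookup (X k) m = (if m = Poly_Mapping.single k 1 then 1 else 0)"
  by (auto simp: X_def lookup_single when_def)

lemma X_eq_iff: "(X k :: 'a::comm_ring_1 mpol) = X l \<longleftrightarrow> k = l"
proof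
  assume "(X k :: 'a mpol) = X l"
  then have "Poly_Mapping.lookup (X k :: 'a mpol) (Poly_Mapping.single k 1)
    = Poly_Mapping.lookup (X l) (Poly_Mapping.single k 1)" by simp
  then show "k = l" using single_var_eq_iff[of k l]
    by (simp add: lookup_X split: if_splits)
qed simp

lemma X_neq_Const: "(X k :: 'a::comm_ring_1 mpol) \<noteq> Const c"
proof
  assume "(X k :: 'a mpol) = Const c"
  then have "Poly_Mapping.lookup (X k :: 'a mpol) (Poly_Mapping.single k 1)
    = Poly_Mapping.lookup (Const c) (Poly_Mapping.single k 1)" by simp
  then show False using single_var_nonzero[of k] by (simp add: lookup_X lookup_Const)
qed

text \<open>
  The substitution of \<open>1\<close> for the indeterminates with index in \<open>S\<close> and \<open>0\<close> for the others: a
  monomial then has value \<open>1\<close> if all its indeterminates have index in \<open>S\<close>, and \<open>0\<close> otherwise,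
  whatever the exponents are.
\<close>

definition eval01 :: "nat set \<Rightarrow> 'a::comm_ring_1 mpol \<Rightarrow> 'a" where
  "eval01 S p = (\<Sum>m\<in>Poly_Mapping.keys p.
     if Poly_Mapping.keys m \<subseteq> S then Poly_Mapping.lookup p m else 0)"

lemma eval01_superset:
  assumes "finite T" "Poly_Mapping.keys p \<subseteq> T"
  shows "eval01 S p = (\<Sum>m\<in>T. if Poly_Mapping.keys m \<subseteq> S then Poly_Mapping.lookup p m else 0)"
  unfolding eval01_def using assms
  by (intro sum.mono_neutral_left) (auto simp: in_keys_iff)

lemma eval01_add: "eval01 S (p + q) = eval01 S p + eval01 S q"
proof -
  let ?T = "Poly_Mapping.keys p \<union> Poly_Mapping.keys q"
  have T: "finite ?T" "Poly_Mapping.keys (p + q) \<subseteq> ?T" "Poly_Mapping.keys p \<subseteq> ?T"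
    "Poly_Mapping.keys q \<subseteq> ?T"
    using keys_add[of p q] by auto
  show ?thesis
    unfolding eval01_superset[OF T(1,2)] eval01_superset[OF T(1,3)] eval01_superset[OF T(1,4)]
    unfolding sum.distrib[symmetric] by (rule sum.cong) (simp_all add: lookup_add)
qed

lemma eval01_zero: "eval01 S 0 = 0"
  by (simp add: eval01_def)

lemma eval01_sum: "eval01 S (\<Sum>i\<in>I. f i) = (\<Sum>i\<in>I. eval01 S (f i))"
  by (induction I rule: infinite_finite_induct) (simp_all add: eval01_add eval01_zero)

lemma eval01_single:
  "eval01 S (Poly_Mapping.single m c) = (if Poly_Mapping.keys m \<subseteq> S then c else 0)"
  by (cases "c = 0") (simp_all add: eval01_def)

lemma eval01_Const: "eval01 S (Const c) = c"
  by (simp add: Const_def eval01_single)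

lemma eval01_X: "eval01 S (X k) = (if k \<in> S then 1 else 0)"
  by (simp add: X_def eval01_single)

lemma sum_single_lookup:
  fixes p :: "'a::comm_ring_1 mpol"
  shows "p = (\<Sum>m\<in>Poly_Mapping.keys p. Poly_Mapping.single m (Poly_Mapping.lookup p m))"
proof (rule poly_mapping_eqI)
  fix k
  have "(\<Sum>m\<in>Poly_Mapping.keys p. if m = k then Poly_Mapping.lookup p m else 0)
      = Poly_Mapping.lookup p k"
    by (simp add: in_keys_iff)
  then show "Poly_Mapping.lookup p k = Poly_Mapping.lookup
      (\<Sum>m\<in>Poly_Mapping.keys p. Poly_Mapping.single m (Poly_Mapping.lookup p m)) k"
    by (simp add: lookup_sum lookup_single when_def)
qed

text \<open>
  Exponents are natural numbers and cannot cancel. This is what makes \<^const>\<open>eval01\<close>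
  multiplicative.
\<close>

lemma keys_add_nat:
  "Poly_Mapping.keys (m + m' :: nat \<Rightarrow>\<^sub>0 nat) = Poly_Mapping.keys m \<union> Poly_Mapping.keys m'"
  by (auto simp: in_keys_iff lookup_add)

lemma eval01_mult: "eval01 S (p * q) = eval01 S p * eval01 S (q :: 'a::comm_ring_1 mpol)"
proof -
  let ?t = "\<lambda>p m. Poly_Mapping.single m (Poly_Mapping.lookup p m) :: 'a mpol"
  let ?K = "Poly_Mapping.keys"
  have t: "eval01 S (?t p m * ?t q m') = eval01 S (?t p m) * eval01 S (?t q m')" for m m'
    by (simp add: mult_single eval01_single keys_add_nat)
  have "eval01 S (p * q) = eval01 S ((\<Sum>m\<in>?K p. ?t p m) * (\<Sum>m\<in>?K q. ?t q m))"
    using sum_single_lookup[of p] sum_single_lookup[of q] by simp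
  also have "\<dots> = (\<Sum>m\<in>?K p. \<Sum>m'\<in>?K q. eval01 S (?t p m) * eval01 S (?t q m'))"
    by (simp only: sum_product eval01_sum t)
  also have "\<dots> = eval01 S (\<Sum>m\<in>?K p. ?t p m) * eval01 S (\<Sum>m\<in>?K q. ?t q m)"
    by (simp only: sum_product eval01_sum)
  finally show ?thesis
    using sum_single_lookup[of p] sum_single_lookup[of q] by simp
qed

lemma comm_ring_hom_eval01: "comm_ring_hom (eval01 S :: 'a::comm_ring_1 mpol \<Rightarrow> 'a)"
proof unfold_locales
  show "eval01 S (1 :: 'a mpol) = 1"
    using eval01_Const[of S 1] by simp
qed (simp_all add: eval01_add eval01_zero eval01_mult)

lemma map_poly_eval01_Const: "map_poly (eval01 S) (map_poly Const p) = p"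
  by (simp add: map_poly_map_poly eval01_zero eval01_Const comp_def)

section \<open>Polynomials affine in the indeterminates\<close>

definition affine_poly :: "nat \<Rightarrow> 'a::comm_ring_1 mpol poly \<Rightarrow> bool" where
  "affine_poly n q \<longleftrightarrow> (\<exists>p0 p. q = map_poly Const p0 +
     (\<Sum>k=1..n. Polynomial.smult (X k) (map_poly Const (p k))))"

lemma affine_poly_Const: "affine_poly n (map_poly Const p)"
  unfolding affine_poly_def by (rule exI[of _ p], rule exI[of _ "\<lambda>_. 0"]) simp

lemma affine_poly_add:
  assumes "affine_poly n q" "affine_poly n q'"
  shows "affine_poly n (q + q')"
proof -
  obtain p0 p p0' p' where
    "q = map_poly Const p0 + (\<Sum>k=1..n. Polynomial.smult (X k) (map_poly Const (p k)))"
    "q' = map_poly Const p0' + (\<Sum>k=1..n. Polynomial.smult (X k) (map_poly Const (p' k)))"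
    using assms unfolding affine_poly_def by blast
  then have "q + q' = map_poly Const (p0 + p0') +
      (\<Sum>k=1..n. Polynomial.smult (X k) (map_poly Const (p k + p' k)))"
    by (simp add: Const_poly_hom.hom_add smult_add_right sum.distrib)
  then show ?thesis
    unfolding affine_poly_def by (intro exI)
qed

lemma affine_poly_Const_mult:
  assumes "affine_poly n q"
  shows "affine_poly n (map_poly Const s * q)"
proof -
  obtain p0 p where
    "q = map_poly Const p0 + (\<Sum>k=1..n. Polynomial.smult (X k) (map_poly Const (p k)))"
    using assms unfolding affine_poly_def by blast
  then have "map_poly Const s * q = map_poly Const (s * p0) +
      (\<Sum>k=1..n. Polynomial.smult (X k) (map_poly Const (s * p k)))"
    by (simp add: Const_poly_hom.hom_mult distrib_left sum_distrib_left)
  then show ?thesis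
    unfolding affine_poly_def by (intro exI)
qed

lemma affine_poly_smult_X:
  assumes "k \<in> {1..n}"
  shows "affine_poly n (Polynomial.smult (X k) (map_poly Const s))"
proof -
  have "(\<Sum>l=1..n. Polynomial.smult (X l) (map_poly Const (if l = k then s else 0)))
      = (\<Sum>l=1..n. if l = k then Polynomial.smult (X k) (map_poly Const s) else 0)"
    by (rule sum.cong) auto
  then have "Polynomial.smult (X k) (map_poly Const s) = map_poly Const 0 +
      (\<Sum>l=1..n. Polynomial.smult (X l) (map_poly Const (if l = k then s else 0)))"
    using assms by simp
  then show ?thesis
    unfolding affine_poly_def by (intro exI)
qed

lemma affine_poly_sum:
  assumes "\<And>i. i \<in> I \<Longrightarrow> affine_poly n (f i)"
  shows "affine_poly n (\<Sum>i\<in>I. f i)"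
  using assms
proof (induction I rule: infinite_finite_induct)
  case (insert i I)
  then show ?case by (simp add: affine_poly_add)
qed (use affine_poly_Const[of n 0] in simp_all)

lemma hess_Const:
  assumes "\<And>i a. a \<le> i \<Longrightarrow> i < m \<Longrightarrow> h i a \<in> range (map_poly Const)"
  shows "hess h m \<in> range (map_poly Const)"
  using assms
proof (induction m rule: less_induct)
  case (less m)
  show ?case
  proof (cases m)
    case 0
    then show ?thesis by (auto intro: range_eqI[of _ _ 1])
  next
    case (Suc k)
    have "\<forall>a\<in>{..k}. \<exists>s. h k a * hess h a = map_poly Const s"
    proof
      fix a assume "a \<in> {..k}"
      then obtain s t where "h k a = map_poly Const s" "hess h a = map_poly Const t"
        using less.prems[of a k] less.IH[of a] less.prems Suc by fastforce
      then show "\<exists>s. h k a * hess h a = map_poly Const s"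
        by (metis Const_poly_hom.hom_mult)
    qed
    then obtain s where s: "\<And>a. a \<le> k \<Longrightarrow> h k a * hess h a = map_poly Const (s a)"
      by (metis atMost_iff)
    have "hess h m = map_poly Const (\<Sum>a\<le>k. s a)"
      using s by (simp add: Suc Const_poly_hom.hom_sum)
    then show ?thesis by blast
  qed
qed

text \<open>
  The hypothesis confines the non-constant entries of \<open>h\<close> to the rows from \<open>b\<close> on and the columns
  up to \<open>b\<close>. In the recursion such an entry \<open>h k a\<close> multiplies the minor of order \<open>a \<le> b\<close>, which
  involves only rows above row \<open>b\<close> and is therefore free of indeterminates.
\<close>

lemma hess_affine:
  assumes h: "\<And>i a. a \<le> i \<Longrightarrow> i < n \<Longrightarrow>
      h i a \<in> range (map_poly Const) \<or> (a \<le> b \<and> b \<le> i \<and> affine_poly N (h i a))"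
    and "m \<le> n"
  shows "affine_poly N (hess h m)"
  using assms(2)
proof (induction m rule: less_induct)
  case (less m)
  show ?case
  proof (cases m)
    case 0
    then show ?thesis using affine_poly_Const[of N 1] by simp
  next
    case (Suc k)
    have "affine_poly N (h k a * hess h a)" if a: "a \<le> k" for a
    proof (cases "h k a \<in> range (map_poly Const)")
      case True
      moreover have "affine_poly N (hess h a)"
        using less Suc a by simp
      ultimately show ?thesis by (auto intro: affine_poly_Const_mult)
    next
      case False
      then have ab: "a \<le> b" and aff: "affine_poly N (h k a)"
        using h[OF a] less.prems Suc by auto
      have "hess h a \<in> range (map_poly Const)"
      proof (rule hess_Const)
        fix i a' assume "a' \<le> i" "i < a"
        then show "h i a' \<in> range (map_poly Const)"
          using h[of a' i] ab a less.prems Suc by auto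
      qed
      then show ?thesis
        using aff by (auto simp: mult.commute intro: affine_poly_Const_mult)
    qed
    then show ?thesis by (auto simp: Suc intro: affine_poly_sum)
  qed
qed

lemma char_poly_form_if_affine:
  assumes A: "A \<in> carrier_mat n n" and "affine_poly n (char_poly A)"
  obtains p where "char_poly_form A p"
proof -
  obtain p0 q where q: "char_poly A = map_poly Const p0 +
     (\<Sum>k=1..n. Polynomial.smult (X k) (map_poly Const (q k)))"
    using assms(2) unfolding affine_poly_def by blast
  define p where "p i = (if i = n then p0 else - q (n - i))" for i
  have "(\<Sum>k=1..n. Polynomial.smult (X k) (map_poly Const (q k)))
      = (\<Sum>k=1..n. - Polynomial.smult (X k) (map_poly Const (p (n - k))))"
    by (rule sum.cong) (auto simp: p_def Const_poly_hom.hom_uminus)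
  then have "char_poly_form A p"
    using A q by (simp add: char_poly_form_def p_def sum_negf)
  then show thesis by (rule that)
qed

text \<open>
  Coefficients at the monomials \<open>1\<close> and \<open>X k\<close> recover the polynomials \<open>p i\<close> from the
  characteristic polynomial, so that they are unique for \<open>i \<le> n\<close> and inherit its bound on the
  degree.
\<close>

lemma char_poly_form_coeff:
  assumes A: "A \<in> carrier_mat n n" and p: "char_poly_form A p"
  shows "coeff (p n) j = Poly_Mapping.lookup (coeff (char_poly A) j) 0"
    and "k \<in> {1..n} \<Longrightarrow> coeff (p (n - k)) j =
      - Poly_Mapping.lookup (coeff (char_poly A) j) (Poly_Mapping.single k 1)"
proof -
  have c: "coeff (char_poly A) j =
      Const (coeff (p n) j) - (\<Sum>k=1..n. X k * Const (coeff (p (n - k)) j))"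
    using A p by (simp add: char_poly_form_def coeff_sum coeff_map_poly)
  show "coeff (p n) j = Poly_Mapping.lookup (coeff (char_poly A) j) 0"
    by (simp add: c lookup_minus lookup_sum X_mult_Const lookup_single when_def lookup_Const
        single_var_nonzero[simplified])
  assume k: "k \<in> {1..n}"
  have "(\<Sum>l=1..n. Poly_Mapping.lookup (X l * Const (coeff (p (n - l)) j)) (Poly_Mapping.single k 1))
      = (\<Sum>l=1..n. if l = k then coeff (p (n - k)) j else 0)"
    by (rule sum.cong) (use single_var_eq_iff in \<open>auto simp: X_mult_Const lookup_single when_def\<close>)
  then show "coeff (p (n - k)) j =
      - Poly_Mapping.lookup (coeff (char_poly A) j) (Poly_Mapping.single k 1)"
    using k single_var_nonzero[of k]
    by (simp add: c lookup_minus lookup_sum lookup_Const)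
qed

lemma char_poly_form_degree:
  assumes A: "A \<in> carrier_mat n n" and p: "char_poly_form A p" and i: "i \<le> n"
  shows "degree (p i) \<le> n"
proof (rule degree_le, intro allI impI)
  fix j assume "n < j"
  then have z: "coeff (char_poly A) j = 0"
    using degree_monic_char_poly[OF A] by (simp add: coeff_eq_0)
  show "coeff (p i) j = 0"
  proof (cases "i = n")
    case True
    then show ?thesis using char_poly_form_coeff(1)[OF A p, of j] z by simp
  next
    case False
    then have "n - i \<in> {1..n}" using i by auto
    from char_poly_form_coeff(2)[OF A p this, of j] show ?thesis using z i by simp
  qed
qed

lemma char_poly_form_unique:
  assumes A: "A \<in> carrier_mat n n" and p: "char_poly_form A p" and q: "char_poly_form A q"
    and i: "i \<le> n"
  shows "p i = q i"
proof (rule poly_eqI)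
  fix j
  show "coeff (p i) j = coeff (q i) j"
  proof (cases "i = n")
    case True
    then show ?thesis
      using char_poly_form_coeff(1)[OF A p, of j] char_poly_form_coeff(1)[OF A q, of j] by simp
  next
    case False
    then have "n - i \<in> {1..n}" using i by auto
    from char_poly_form_coeff(2)[OF A p this, of j] char_poly_form_coeff(2)[OF A q this, of j]
    show ?thesis using i by simp
  qed
qed

definition coeff_rows :: "nat \<Rightarrow> (nat \<Rightarrow> 'a::zero poly) \<Rightarrow> 'a mat" where
  "coeff_rows n p = mat (n + 1) (n + 1) (\<lambda>(i, j). coeff (p i) j)"

lemma coeff_matrix_eq:
  assumes A: "A \<in> carrier_mat n n" and p: "char_poly_form A p"
  shows "coeff_matrix A = coeff_rows n p"
proof -
  have n: "dim_row A = n" using A by simp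
  show ?thesis
    unfolding coeff_matrix_def Let_def n
  proof (rule the_equality)
    show "\<exists>q. (\<forall>i\<le>n. q i \<in> poly_space n) \<and> char_poly_form A q \<and>
       coeff_rows n p = mat (n + 1) (n + 1) (\<lambda>(i, j). coeff (q i) j)"
      using p char_poly_form_degree[OF A p]
      by (intro exI[of _ p]) (auto simp: poly_space_def coeff_rows_def)
  next
    fix M assume "\<exists>q. (\<forall>i\<le>n. q i \<in> poly_space n) \<and> char_poly_form A q \<and>
       M = mat (n + 1) (n + 1) (\<lambda>(i, j). coeff (q i) j)"
    then obtain q where "char_poly_form A q" "M = coeff_rows n q"
      by (auto simp: coeff_rows_def)
    with char_poly_form_unique[OF A p this(1)] show "M = coeff_rows n p"
      by (auto simp: coeff_rows_def intro!: cong_mat)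
  qed
qed

section \<open>Bases and invertible coefficient matrices\<close>

interpretation smult_module: Modules.module "Polynomial.smult :: 'a::comm_ring_1 \<Rightarrow> _"
  by unfold_locales (simp_all add: smult_add_right smult_add_left)

text \<open>
  Left multiplication of the coefficient matrix forms linear combinations of the polynomials. With
  \<open>coeff_rows_eq_iff\<close> and \<open>coeff_rows_monom\<close>, matrix identities become identities between
  polynomials.
\<close>

lemma coeff_rows_mult:
  fixes U :: "'a::field mat"
  assumes p: "\<And>i. i \<le> n \<Longrightarrow> degree (p i) \<le> n"
    and U: "U \<in> carrier_mat (n + 1) (n + 1)"
  shows "U * coeff_rows n p
    = coeff_rows n (\<lambda>i. \<Sum>l\<le>n. Polynomial.smult (U $$ (i, l)) (p l))"
  using U by (intro eq_matI)
    (auto simp: coeff_rows_def scalar_prod_def coeff_sum atLeastLessThanSuc_atLeastAtMost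
      atMost_atLeast0)

lemma coeff_rows_eq_iff:
  assumes "\<And>i. i \<le> n \<Longrightarrow> degree (p i) \<le> n" "\<And>i. i \<le> n \<Longrightarrow> degree (q i) \<le> n"
  shows "coeff_rows n p = coeff_rows n q \<longleftrightarrow> (\<forall>i\<le>n. p i = q i)"
proof
  assume eq: "coeff_rows n p = coeff_rows n q"
  show "\<forall>i\<le>n. p i = q i"
  proof (intro allI impI poly_eqI)
    fix i j assume i: "i \<le> n"
    show "coeff (p i) j = coeff (q i) j"
    proof (cases "j \<le> n")
      case True
      with i have "coeff_rows n p $$ (i, j) = coeff (p i) j" "coeff_rows n q $$ (i, j) = coeff (q i) j"
        by (simp_all add: coeff_rows_def)
      with eq show ?thesis by simp
    next
      case False
      then show ?thesis using assms[OF i] by (simp add: coeff_eq_0)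
    qed
  qed
qed (auto simp: coeff_rows_def intro!: cong_mat)

lemma coeff_rows_monom: "coeff_rows n (monom 1) = 1\<^sub>m (n + 1)"
  by (rule eq_matI) (auto simp: coeff_rows_def)

lemma invertible_mat_iff_left_inverse:
  fixes P :: "'a::field mat"
  assumes "P \<in> carrier_mat n n"
  shows "invertible_mat P \<longleftrightarrow> (\<exists>U\<in>carrier_mat n n. U * P = 1\<^sub>m n)"
proof
  assume "invertible_mat P"
  then obtain U where U: "P * U = 1\<^sub>m n" "U * P = 1\<^sub>m (dim_row U)"
    using assms by (auto simp: invertible_mat_def inverts_mat_def)
  have "dim_col U = n" using arg_cong[OF U(1), of dim_col] by simp
  moreover have "dim_row U = n" using arg_cong[OF U(2), of dim_col] assms by simp
  ultimately show "\<exists>U\<in>carrier_mat n n. U * P = 1\<^sub>m n" using U(2) by auto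
next
  assume "\<exists>U\<in>carrier_mat n n. U * P = 1\<^sub>m n"
  then obtain U where "U \<in> carrier_mat n n" "U * P = 1\<^sub>m n" by blast
  then show "invertible_mat P"
    using mat_mult_left_right_inverse[of U n P] assms
    by (auto simp: invertible_mat_def inverts_mat_def intro!: exI[of _ U])
qed

lemma span_image_eq:
  fixes p :: "'i \<Rightarrow> 'a::field poly"
  assumes "finite I"
  shows "smult_module.span (p ` I) = range (\<lambda>u. \<Sum>i\<in>I. Polynomial.smult (u i) (p i))"
proof (intro equalityI subsetI)
  fix x assume "x \<in> smult_module.span (p ` I)"
  then show "x \<in> range (\<lambda>u. \<Sum>i\<in>I. Polynomial.smult (u i) (p i))"
  proof (induction rule: smult_module.span_induct_alt)
    case base
    show ?case by (rule range_eqI[of _ _ "\<lambda>_. 0"]) simp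
  next
    case (step c x y)
    then obtain j u where j: "j \<in> I" "x = p j" and y: "y = (\<Sum>i\<in>I. Polynomial.smult (u i) (p i))"
      by auto
    have "(\<Sum>i\<in>I. Polynomial.smult (if i = j then c else 0) (p i))
        = (\<Sum>i\<in>I. if i = j then Polynomial.smult c (p j) else 0)"
      by (rule sum.cong) auto
    then have "Polynomial.smult c x + y
        = (\<Sum>i\<in>I. Polynomial.smult ((if i = j then c else 0) + u i) (p i))"
      using j y assms by (simp add: smult_add_left sum.distrib)
    then show ?case by (rule range_eqI[where x = "\<lambda>i. (if i = j then c else 0) + u i"])
  qed
next
  fix x assume "x \<in> range (\<lambda>u. \<Sum>i\<in>I. Polynomial.smult (u i) (p i))"
  then show "x \<in> smult_module.span (p ` I)"
    by (auto intro!: smult_module.span_sum smult_module.span_scale intro: smult_module.span_base)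
qed

lemma subspace_poly_space: "smult_module.subspace (poly_space n)"
  by (auto simp: smult_module.subspace_def poly_space_def
      intro: degree_add_le le_trans[OF degree_smult_le])

text \<open>
  A spanning family expresses the monomials \<open>1, \<lambda>, \<dots>, \<lambda>^n\<close>, and the coefficients of these
  expressions form a left inverse. Conversely, a left inverse expresses the monomials, and as it is
  also a right inverse, only the zero combination of the rows vanishes. The latter gives linear
  independence together with injectivity of \<open>p\<close>, which is needed because
  \<^const>\<open>is_poly_basis\<close> speaks about a set rather than a family.
\<close>

lemma is_poly_basis_iff_invertible:
  fixes p :: "nat \<Rightarrow> 'a::field poly"
  assumes p: "\<And>i. i \<le> n \<Longrightarrow> degree (p i) \<le> n"
  shows "is_poly_basis n (p ` {0..n}) \<longleftrightarrow> invertible_mat (coeff_rows n p)"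
proof -
  have P: "coeff_rows n p \<in> carrier_mat (n + 1) (n + 1)" by (simp add: coeff_rows_def)
  note inv = invertible_mat_iff_left_inverse[OF P]
  have comb: "degree (\<Sum>l\<le>n. Polynomial.smult (u l) (p l)) \<le> n" for u
    using p by (intro degree_sum_le) (auto intro: le_trans[OF degree_smult_le])
  show ?thesis
  proof
    assume "is_poly_basis n (p ` {0..n})"
    then have span: "range (\<lambda>u. \<Sum>i\<le>n. Polynomial.smult (u i) (p i)) = poly_space n"
      using span_image_eq[of "{..n}" p] by (simp add: is_poly_basis_def atMost_atLeast0)
    have "\<forall>i. \<exists>u. i \<le> n \<longrightarrow> monom 1 i = (\<Sum>l\<le>n. Polynomial.smult (u l) (p l))"
    proof
      fix i
      show "\<exists>u. i \<le> n \<longrightarrow> monom 1 i = (\<Sum>l\<le>n. Polynomial.smult (u l) (p l))"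
      proof (cases "i \<le> n")
        case True
        then have "monom (1::'a) i \<in> poly_space n" by (simp add: poly_space_def degree_monom_eq)
        then show ?thesis unfolding span[symmetric] by blast
      qed simp
    qed
    then obtain u where u: "\<And>i. i \<le> n \<Longrightarrow> monom 1 i = (\<Sum>l\<le>n. Polynomial.smult (u i l) (p l))"
      by metis
    define U where "U = mat (n + 1) (n + 1) (\<lambda>(i, l). u i l)"
    have U: "U \<in> carrier_mat (n + 1) (n + 1)" by (simp add: U_def)
    have "(\<Sum>l\<le>n. Polynomial.smult (U $$ (i, l)) (p l)) = monom 1 i" if "i \<le> n" for i
      unfolding u[OF that] using that by (intro sum.cong) (simp_all add: U_def)
    then have "coeff_rows n (\<lambda>i. \<Sum>l\<le>n. Polynomial.smult (U $$ (i, l)) (p l)) = coeff_rows n (monom 1)"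
      by (auto simp: coeff_rows_def intro!: cong_mat)
    then have "U * coeff_rows n p = coeff_rows n (monom 1)"
      using coeff_rows_mult[OF p U] by simp
    then show "invertible_mat (coeff_rows n p)"
      unfolding inv coeff_rows_monom using U by blast
  next
    assume "invertible_mat (coeff_rows n p)"
    then obtain U where U: "U \<in> carrier_mat (n + 1) (n + 1)" "U * coeff_rows n p = 1\<^sub>m (n + 1)"
      unfolding inv by blast
    have PU: "coeff_rows n p * U = 1\<^sub>m (n + 1)"
      by (rule mat_mult_left_right_inverse[OF U(1) P U(2)])
    have monom: "(\<Sum>l\<le>n. Polynomial.smult (U $$ (i, l)) (p l)) = monom 1 i" if "i \<le> n" for i
    proof -
      have "coeff_rows n (\<lambda>i. \<Sum>l\<le>n. Polynomial.smult (U $$ (i, l)) (p l)) = coeff_rows n (monom 1)"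
        using U(2) coeff_rows_mult[OF p U(1)] by (simp only: coeff_rows_monom)
      then show ?thesis
        using that coeff_rows_eq_iff[of n _ "monom 1", OF comb]
        by (simp add: degree_monom_eq)
    qed
    have indep: "u i = 0" if u: "(\<Sum>l\<le>n. Polynomial.smult (u l) (p l)) = 0" and i: "i \<le> n" for u i
    proof -
      define W where "W = mat (n + 1) (n + 1) (\<lambda>(i, l). u l)"
      have W: "W \<in> carrier_mat (n + 1) (n + 1)" by (simp add: W_def)
      have "(\<Sum>l\<le>n. Polynomial.smult (W $$ (i, l)) (p l)) = 0" if "i \<le> n" for i
        unfolding u[symmetric] using that by (intro sum.cong) (simp_all add: W_def)
      then have "coeff_rows n (\<lambda>i. \<Sum>l\<le>n. Polynomial.smult (W $$ (i, l)) (p l)) = 0\<^sub>m (n + 1) (n + 1)"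
        by (intro eq_matI) (auto simp: coeff_rows_def)
      then have "W * coeff_rows n p = 0\<^sub>m (n + 1) (n + 1)"
        using coeff_rows_mult[OF p W] by simp
      then have "W * coeff_rows n p * U = 0\<^sub>m (n + 1) (n + 1)" using U(1) by simp
      then have "W = 0\<^sub>m (n + 1) (n + 1)"
        using assoc_mult_mat[OF W P U(1)] PU W by simp
      then have "W $$ (0, i) = 0" using i by simp
      then show ?thesis using i by (simp add: W_def)
    qed
    have inj: "inj_on p {0..n}"
    proof (rule inj_onI, rule ccontr)
      fix i j assume ij: "i \<in> {0..n}" "j \<in> {0..n}" "p i = p j" "i \<noteq> j"
      define u where "u l = (if l = i then 1 else 0) - (if l = j then 1 else (0::'a))" for l
      have "(\<Sum>l\<le>n. Polynomial.smult (u l) (p l))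
          = (\<Sum>l\<le>n. (if l = i then p i else 0) - (if l = j then p j else 0))"
        by (rule sum.cong) (auto simp: u_def)
      also have "\<dots> = 0" using ij by (simp add: sum_subtractf)
      finally have "u i = 0" using indep ij by simp
      then show False using ij by (simp add: u_def)
    qed
    have "\<not> smult_module.dependent (p ` {0..n})"
    proof
      assume "smult_module.dependent (p ` {0..n})"
      then have "\<exists>u. (\<exists>v\<in>p ` {0..n}. u v \<noteq> 0) \<and>
          (\<Sum>v\<in>p ` {0..n}. Polynomial.smult (u v) v) = 0"
        by (subst (asm) smult_module.dependent_finite) simp_all
      then obtain u l where l: "l \<le> n" "u (p l) \<noteq> 0"
        and s: "(\<Sum>v\<in>p ` {0..n}. Polynomial.smult (u v) v) = 0"
        by (elim exE conjE bexE imageE) simp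
      have "(\<Sum>l\<le>n. Polynomial.smult (u (p l)) (p l)) = 0"
        using s by (simp add: sum.reindex[OF inj] atMost_atLeast0)
      then show False using indep[of "\<lambda>l. u (p l)" l] l by blast
    qed
    moreover have "smult_module.span (p ` {0..n}) = poly_space n"
    proof (rule smult_module.span_subspace)
      show "p ` {0..n} \<subseteq> poly_space n"
      proof (rule image_subsetI)
        fix i assume "i \<in> {0..n}"
        then show "p i \<in> poly_space n" using p[of i] by (simp add: poly_space_def)
      qed
      show "poly_space n \<subseteq> smult_module.span (p ` {0..n})"
      proof
        fix q :: "'a poly" assume "q \<in> poly_space n"
        then have "q = (\<Sum>i\<le>n. Polynomial.smult (coeff q i) (monom 1 i))"
          using poly_as_sum_of_monoms'[of q n] by (simp add: poly_space_def smult_monom)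
        also have "\<dots> = (\<Sum>i\<le>n. Polynomial.smult (coeff q i)
            (\<Sum>l\<le>n. Polynomial.smult (U $$ (i, l)) (p l)))"
          by (rule sum.cong) (simp_all add: monom)
        also have "\<dots> \<in> smult_module.span (p ` {0..n})"
          by (auto intro!: smult_module.span_sum smult_module.span_scale
              intro: smult_module.span_base)
        finally show "q \<in> smult_module.span (p ` {0..n})" .
      qed
    qed (rule subspace_poly_space)
    ultimately show "is_poly_basis n (p ` {0..n})" by (simp add: is_poly_basis_def)
  qed
qed

section \<open>Superpatterns and the positions of their variables\<close>

lemma vars_atD:
  assumes "vars_at A r c" "A \<in> carrier_mat n n" "k \<in> {1..n}"
  shows "r k \<in> {1..n}" "c k \<in> {1..n}" "entry A (r k) (c k) = X k"
  using assms by (auto simp: vars_at_def)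

lemma ulhD:
  assumes "ulh A" "A \<in> carrier_mat n n" "i \<in> {1..n}" "j \<in> {1..n}"
  shows "j = i + 1 \<Longrightarrow> entry A i j = 1" "i + 1 < j \<Longrightarrow> entry A i j = 0"
proof -
  have "\<forall>i\<in>{1..n}. \<forall>j\<in>{1..n}.
      (j = i + 1 \<longrightarrow> entry A i j = 1) \<and> (i + 1 < j \<longrightarrow> entry A i j = 0)"
    using assms(1,2) unfolding ulh_def Let_def by simp
  then show "j = i + 1 \<Longrightarrow> entry A i j = 1" "i + 1 < j \<Longrightarrow> entry A i j = 0"
    using assms(3,4) by blast+
qed

lemma X_neq_0: "(X k :: 'a::comm_ring_1 mpol) \<noteq> 0" and X_neq_1: "(X k :: 'a mpol) \<noteq> 1"
  using X_neq_Const[of k 0] X_neq_Const[of k 1] by simp_all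

lemma ulh_var_below_diagonal:
  assumes "ulh A" "A \<in> carrier_mat n n" "i \<in> {1..n}" "j \<in> {1..n}" "entry A i j = X k"
  shows "j \<le> i"
proof (rule ccontr)
  assume "\<not> j \<le> i"
  then consider "j = i + 1" | "i + 1 < j" by linarith
  then show False
    using ulhD[OF assms(1-4)] assms(5) X_neq_0[of k] X_neq_1[of k] by cases auto
qed

definition const_off_vars :: "'a::field mpol mat \<Rightarrow> (nat \<Rightarrow> nat) \<Rightarrow> (nat \<Rightarrow> nat) \<Rightarrow> bool" where
  "const_off_vars A r c \<longleftrightarrow> (\<forall>i\<in>{1..dim_row A}. \<forall>j\<in>{1..dim_row A}.
     (\<forall>k\<in>{1..dim_row A}. (i, j) \<noteq> (r k, c k)) \<longrightarrow> entry A i j \<in> range Const)"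

lemma const_off_varsD:
  assumes "const_off_vars A r c" "A \<in> carrier_mat n n" "i \<in> {1..n}" "j \<in> {1..n}"
    and "\<And>k. k \<in> {1..n} \<Longrightarrow> (i, j) \<noteq> (r k, c k)"
  shows "entry A i j \<in> range Const"
  using assms by (auto simp: const_off_vars_def)

text \<open>
  A superpattern keeps the variables of the underlying matrix, as these are nonzero, and differs
  from it only in constants. Hence \<open>A\<close> lies in \<^const>\<open>B_tilde\<close> if and only if \<open>A\<close> itself is unit
  lower Hessenberg with constants away from its ordered variables, and the intervals of any two
  variables meet. The two directions, \<open>B_tildeD\<close> and \<open>B_tildeI\<close>, allow working with \<open>A\<close> alone.
\<close>

lemma B_tildeD:
  fixes A :: "'a::field mpol mat"
  assumes "A \<in> B_tilde"
  obtains n r c where "n \<ge> 1" "A \<in> carrier_mat n n" "ulh A" "vars_at A r c" "const_off_vars A r c"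
    "\<And>k l. k \<in> {1..n} \<Longrightarrow> l \<in> {1..n} \<Longrightarrow> c k \<le> r l"
proof -
  obtain M n r c where n: "n \<ge> 1" and M: "M \<in> carrier_mat n n" "ulh M" "vars_at M r c"
    and max: "Max (c ` {1..n}) \<le> Min (r ` {1..n})"
    and zero: "\<And>i j. i \<in> {1..n} \<Longrightarrow> j \<in> {1..n} \<Longrightarrow> j \<le> i \<Longrightarrow>
      \<forall>k\<in>{1..n}. (i, j) \<noteq> (r k, c k) \<Longrightarrow> entry M i j = 0"
    and sup: "ulh_superpattern A M"
    using assms unfolding B_tilde_def B_set_def by blast
  have A: "A \<in> carrier_mat n n"
    using sup M(1) by (simp add: ulh_superpattern_def Let_def)
  have ent: "entry A i j = entry M i j \<or>
      (j \<le> i \<and> entry M i j = 0 \<and> (\<exists>c. c \<noteq> 0 \<and> entry A i j = Const c))"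
    if "i \<in> {1..n}" "j \<in> {1..n}" for i j
    using sup M(1) that unfolding ulh_superpattern_def Let_def by simp
  show thesis
  proof (rule that[OF n A])
    show "ulh A"
      unfolding ulh_def Let_def
    proof (intro conjI ballI)
      fix i j assume "i \<in> {1..dim_row A}" "j \<in> {1..dim_row A}"
      then have ij: "i \<in> {1..n}" "j \<in> {1..n}" using A by auto
      show "j = i + 1 \<longrightarrow> entry A i j = 1"
        using ent[OF ij] ulhD[OF M(2,1) ij] by auto
      show "i + 1 < j \<longrightarrow> entry A i j = 0"
        using ent[OF ij] ulhD[OF M(2,1) ij] by auto
    qed (use A in simp)
    show "vars_at A r c"
      unfolding vars_at_def Let_def
    proof
      fix k assume "k \<in> {1..dim_row A}"
      then have k: "k \<in> {1..n}" using A by simp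
      note v = vars_atD[OF M(3,1) k]
      show "r k \<in> {1..dim_row A} \<and> c k \<in> {1..dim_row A} \<and> entry A (r k) (c k) = X k"
        using ent[OF v(1,2)] v A X_neq_0[of k] by auto
    qed
    show "const_off_vars A r c"
      unfolding const_off_vars_def
    proof (intro ballI impI)
      fix i j assume "i \<in> {1..dim_row A}" "j \<in> {1..dim_row A}"
        and off: "\<forall>k\<in>{1..dim_row A}. (i, j) \<noteq> (r k, c k)"
      then have ij: "i \<in> {1..n}" "j \<in> {1..n}" using A by auto
      consider "j \<le> i" | "j = i + 1" | "i + 1 < j" by linarith
      then have "entry M i j \<in> {Const 0, Const 1}"
        by cases (use zero[OF ij] off ulhD[OF M(2,1) ij] A in auto)
      then show "entry A i j \<in> range Const"
        using ent[OF ij] by (auto intro: range_eqI[of _ Const 0] range_eqI[of _ Const 1])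
    qed
    fix k l assume "k \<in> {1..n}" "l \<in> {1..n}"
    then have "c k \<le> Max (c ` {1..n})" "Min (r ` {1..n}) \<le> r l" by auto
    then show "c k \<le> r l" using max by linarith
  qed
qed

lemma B_tildeI:
  fixes A :: "'a::field mpol mat"
  assumes n: "n \<ge> 1" and A: "A \<in> carrier_mat n n" and "ulh A"
    and vars: "vars_at A r c" and chain: "prec_chain n r c" and const: "const_off_vars A r c"
    and le: "\<And>k l. k \<in> {1..n} \<Longrightarrow> l \<in> {1..n} \<Longrightarrow> c k \<le> r l"
  shows "A \<in> B_tilde"
proof -
  \<comment> \<open>The underlying member of \<^const>\<open>B_set\<close> arises from \<open>A\<close> by erasing the constants on and
    below the diagonal.\<close>
  define keep where "keep i j \<longleftrightarrow> i < j \<or> (\<exists>k\<in>{1..n}. (i, j) = (r k, c k))" for i j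
  define M where "M = mat n n (\<lambda>(i, j). if keep (i + 1) (j + 1) then A $$ (i, j) else 0)"
  have M: "M \<in> carrier_mat n n" by (simp add: M_def)
  have ent: "entry M i j = (if keep i j then entry A i j else 0)"
    if "i \<in> {1..n}" "j \<in> {1..n}" for i j
    using that by (auto simp: M_def entry_def)
  have "ulh M"
    unfolding ulh_def Let_def
  proof (intro conjI ballI)
    fix i j assume "i \<in> {1..dim_row M}" "j \<in> {1..dim_row M}"
    then have ij: "i \<in> {1..n}" "j \<in> {1..n}" using M by auto
    show "j = i + 1 \<longrightarrow> entry M i j = 1" "i + 1 < j \<longrightarrow> entry M i j = 0"
      using ent[OF ij] ulhD[OF \<open>ulh A\<close> A ij] by (auto simp: keep_def)
  qed (use M in simp)
  moreover have "vars_at M r c"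
    unfolding vars_at_def Let_def
  proof
    fix k assume "k \<in> {1..dim_row M}"
    then have k: "k \<in> {1..n}" using M by simp
    note v = vars_atD[OF vars A k]
    have "keep (r k) (c k)" using k by (auto simp: keep_def)
    then show "r k \<in> {1..dim_row M} \<and> c k \<in> {1..dim_row M} \<and> entry M (r k) (c k) = X k"
      using ent[OF v(1,2)] v M by simp
  qed
  moreover have "Max (c ` {1..n}) \<le> Min (r ` {1..n})"
    using n le by (subst Max_le_iff) (auto simp: Min_ge_iff)
  moreover have "\<forall>i\<in>{1..n}. \<forall>j\<in>{1..n}.
      j \<le> i \<and> (\<forall>k\<in>{1..n}. (i, j) \<noteq> (r k, c k)) \<longrightarrow> entry M i j = 0"
  proof (intro ballI impI)
    fix i j assume ij: "i \<in> {1..n}" "j \<in> {1..n}"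
      and "j \<le> i \<and> (\<forall>k\<in>{1..n}. (i, j) \<noteq> (r k, c k))"
    then have "\<not> keep i j" by (auto simp: keep_def)
    then show "entry M i j = 0" using ent[OF ij] by simp
  qed
  ultimately have "M \<in> B_set"
    unfolding B_set_def using n M chain by blast
  moreover have "ulh_superpattern A M"
    unfolding ulh_superpattern_def Let_def
  proof (intro conjI ballI)
    fix i j assume "i \<in> {1..dim_row M}" "j \<in> {1..dim_row M}"
    then have ij: "i \<in> {1..n}" "j \<in> {1..n}" using M by auto
    show "entry A i j = entry M i j \<or>
        (j \<le> i \<and> entry M i j = 0 \<and> (\<exists>c. c \<noteq> 0 \<and> entry A i j = Const c))"
    proof (cases "keep i j")
      case True
      then show ?thesis using ent[OF ij] by simp
    next
      case False
      then obtain d where "entry A i j = Const d"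
        using const_off_varsD[OF const A ij] by (auto simp: keep_def)
      then show ?thesis using False ent[OF ij] by (cases "d = 0") (auto simp: keep_def)
    qed
  qed (use M A \<open>ulh M\<close> in auto)
  ultimately show ?thesis unfolding B_tilde_def by blast
qed

lemma char_entry_cases:
  assumes A: "A \<in> carrier_mat n n" and vars: "vars_at A r c" and const: "const_off_vars A r c"
    and ij: "i < n" "j < n"
  shows "char_entry A i j \<in> range (map_poly Const) \<or>
    (\<exists>k\<in>{1..n}. i = r k - 1 \<and> j = c k - 1 \<and>
      (\<exists>s. char_entry A i j = map_poly Const s - Polynomial.smult (X k) (map_poly Const 1)))"
proof -
  define d where "d = (if i = j then [:0, 1:] else 0 :: 'a poly)"
  have d: "(if i = j then [:0, 1:] else 0) = map_poly Const d"
    by (simp add: d_def Const_hom.map_poly_pCons_hom)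
  show ?thesis
  proof (cases "\<exists>k\<in>{1..n}. (i + 1, j + 1) = (r k, c k)")
    case True
    then obtain k where k: "k \<in> {1..n}" "r k = i + 1" "c k = j + 1" by auto
    then have "A $$ (i, j) = X k"
      using vars_atD(3)[OF vars A k(1)] by (simp add: entry_def)
    then have "char_entry A i j = map_poly Const d - Polynomial.smult (X k) (map_poly Const 1)"
      using d by (simp add: char_entry_def)
    then show ?thesis
      using k by (intro disjI2 bexI[of _ k] conjI exI[of _ d]) simp_all
  next
    case False
    then have "entry A (i + 1) (j + 1) \<in> range Const"
      using ij by (intro const_off_varsD[OF const A]) auto
    then obtain b where "A $$ (i, j) = Const b" by (auto simp: entry_def)
    then have "char_entry A i j = map_poly Const (d - [:b:])"
      using d by (simp add: char_entry_def Const_poly_hom.hom_minus Const_hom.map_poly_pCons_hom)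
    then show ?thesis by blast
  qed
qed

section \<open>Affine characteristic polynomials\<close>

lemma char_poly_form_exists:
  assumes n: "n \<ge> 1" and A: "A \<in> carrier_mat n n" and "ulh A"
    and vars: "vars_at A r c" and const: "const_off_vars A r c"
    and le: "\<And>k l. k \<in> {1..n} \<Longrightarrow> l \<in> {1..n} \<Longrightarrow> c k \<le> r l"
  shows "\<exists>p. char_poly_form A p"
proof -
  \<comment> \<open>The first row, counted from 0, that contains a variable separates rows from columns.\<close>
  define b where "b = Min (r ` {1..n}) - 1"
  have b: "c k - 1 \<le> b" "b \<le> r k - 1" if "k \<in> {1..n}" for k
  proof -
    have "Min (r ` {1..n}) \<in> r ` {1..n}" using n by (intro Min_in) auto
    then obtain l where "l \<in> {1..n}" "Min (r ` {1..n}) = r l" by auto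
    then show "c k - 1 \<le> b" using le[OF that] by (simp add: b_def diff_le_mono)
    show "b \<le> r k - 1" using that by (simp add: b_def diff_le_mono)
  qed
  have "affine_poly n (hess (char_entry A) n)"
  proof (rule hess_affine[where n = n and b = b])
    fix i a assume ai: "a \<le> i" "i < n"
    then have "a < n" by simp
    show "char_entry A i a \<in> range (map_poly Const) \<or>
        a \<le> b \<and> b \<le> i \<and> affine_poly n (char_entry A i a)"
      using char_entry_cases[OF A vars const \<open>i < n\<close> \<open>a < n\<close>]
    proof (elim disjE bexE conjE exE)
      fix k s assume k: "k \<in> {1..n}" "i = r k - 1" "a = c k - 1"
        and "char_entry A i a = map_poly Const s - Polynomial.smult (X k) (map_poly Const 1)"
      then have "char_entry A i a
          = map_poly Const s + Polynomial.smult (X k) (map_poly Const (- 1))"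
        by (simp add: Const_poly_hom.hom_uminus)
      then have "affine_poly n (char_entry A i a)"
        using affine_poly_add[OF affine_poly_Const affine_poly_smult_X[OF k(1)]] by metis
      then show ?thesis using b[OF k(1)] k by simp
    qed simp
  qed simp
  then show ?thesis
    using char_poly_form_if_affine[OF A] char_poly_ulh[OF A \<open>ulh A\<close>] by metis
qed

lemma hess_hom:
  assumes "comm_ring_hom f"
  shows "f (hess h n) = hess (\<lambda>i j. f (h i j)) n"
proof -
  interpret comm_ring_hom f by fact
  show ?thesis
  proof (induction n rule: less_induct)
    case (less n)
    then show ?case by (cases n) (simp_all add: hom_sum hom_mult)
  qed
qed

lemma map_poly_eval01_char_entry:
  "map_poly (eval01 S) (char_entry A i j)
    = (if i = j then [:0, 1:] else 0) - [:eval01 S (A $$ (i, j)):]"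
proof -
  interpret e: comm_ring_hom "eval01 S :: 'a mpol \<Rightarrow> 'a" by (rule comm_ring_hom_eval01)
  interpret ep: map_poly_comm_ring_hom "eval01 S :: 'a mpol \<Rightarrow> 'a" ..
  show ?thesis
    by (simp add: char_entry_def ep.hom_minus e.map_poly_pCons_hom)
qed

lemma eval01_char_entry:
  fixes A :: "'a::field mpol mat"
  assumes A: "A \<in> carrier_mat n n" and vars: "vars_at A r c" and const: "const_off_vars A r c"
    and ij: "i < n" "j < n"
  shows "map_poly (eval01 S) (char_entry A i j) = map_poly (eval01 {}) (char_entry A i j)
    - (if \<exists>s\<in>S \<inter> {1..n}. i = r s - 1 \<and> j = c s - 1 then 1 else 0)"
proof -
  have pos: "(\<exists>s\<in>S \<inter> {1..n}. i = r s - 1 \<and> j = c s - 1)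
      \<longleftrightarrow> (\<exists>s\<in>S \<inter> {1..n}. (i + 1, j + 1) = (r s, c s))"
  proof (rule bex_cong[OF refl])
    fix s assume "s \<in> S \<inter> {1..n}"
    then have "1 \<le> r s" "1 \<le> c s" using vars_atD(1,2)[OF vars A, of s] by auto
    then show "(i = r s - 1 \<and> j = c s - 1) \<longleftrightarrow> (i + 1, j + 1) = (r s, c s)" by auto
  qed
  show ?thesis
  proof (cases "\<exists>s\<in>{1..n}. (i + 1, j + 1) = (r s, c s)")
    case True
    then obtain s where s: "s \<in> {1..n}" "(i + 1, j + 1) = (r s, c s)" by blast
    have X: "A $$ (i, j) = X t" if "t \<in> {1..n}" "(i + 1, j + 1) = (r t, c t)" for t
      using vars_atD(3)[OF vars A that(1)] that(2)[symmetric] by (simp add: entry_def)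
    have uniq: "t = s" if "t \<in> {1..n}" "(i + 1, j + 1) = (r t, c t)" for t
      using X[OF that] X[OF s] X_eq_iff[of t s, where 'a = 'a] by simp
    have "(\<exists>t\<in>S \<inter> {1..n}. (i + 1, j + 1) = (r t, c t)) \<longleftrightarrow> s \<in> S"
    proof
      assume "\<exists>t\<in>S \<inter> {1..n}. (i + 1, j + 1) = (r t, c t)"
      then show "s \<in> S" using uniq by blast
    qed (use s in blast)
    then show ?thesis
      unfolding pos by (simp add: map_poly_eval01_char_entry X[OF s] eval01_X one_pCons)
  next
    case False
    then have "entry A (i + 1) (j + 1) \<in> range Const"
      using ij by (intro const_off_varsD[OF const A]) auto
    then obtain b where "A $$ (i, j) = Const b" by (auto simp: entry_def)
    moreover have "\<not> (\<exists>s\<in>S \<inter> {1..n}. (i + 1, j + 1) = (r s, c s))"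
      using False by blast
    ultimately show ?thesis
      unfolding pos by (simp add: map_poly_eval01_char_entry eval01_Const)
  qed
qed

text \<open>
  If the interval of \<open>l\<close> ended before that of \<open>k\<close> begins, the second difference over the
  evaluations at \<open>{}\<close>, \<open>{l}\<close>, \<open>{k}\<close> and \<open>{k, l}\<close> would be nonzero by
  \<open>hess_second_difference_nonzero\<close>, whereas it is zero for every function that is affine in the
  variables.
\<close>

lemma var_intervals_overlap:
  fixes A :: "'a::field mpol mat"
  assumes A: "A \<in> carrier_mat n n" and "ulh A"
    and vars: "vars_at A r c" and const: "const_off_vars A r c"
    and form: "char_poly_form A p"
    and kl: "k \<in> {1..n}" "l \<in> {1..n}"
  shows "c k \<le> r l"
proof (rule ccontr)
  assume "\<not> c k \<le> r l"
  then have gt: "r l < c k" by simp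
  have low: "c s \<le> r s" if "s \<in> {1..n}" for s
    using ulh_var_below_diagonal[OF \<open>ulh A\<close> A] vars_atD[OF vars A that] by blast
  have neq: "k \<noteq> l" using gt low[OF kl(1)] by auto
  define h where "h S i j = map_poly (eval01 S) (char_entry A i j)" for S i j
  define D where "D S = hess (h S) n" for S
  note h = eval01_char_entry[OF A vars const, folded h_def]
  let ?L = "\<lambda>g. decr_entry g (r l - 1) (c l - 1)"
  let ?K = "\<lambda>g. decr_entry g (r k - 1) (c k - 1)"
  have pos: "c l - 1 \<le> r l - 1" "r l - 1 < c k - 1" "c k - 1 \<le> r k - 1" "r k - 1 < n"
    using low[OF kl(1)] low[OF kl(2)] gt vars_atD[OF vars A kl(1)] vars_atD[OF vars A kl(2)]
    by auto
  have Dl: "D {l} = hess (?L (h {})) n"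
    unfolding D_def by (rule hess_cong) (use kl in \<open>simp add: h[of _ _ "{l}"] decr_entry_def\<close>)
  have Dk: "D {k} = hess (?K (h {})) n"
    unfolding D_def by (rule hess_cong) (use kl in \<open>simp add: h[of _ _ "{k}"] decr_entry_def\<close>)
  have Dkl: "D {k, l} = hess (?K (?L (h {}))) n"
    unfolding D_def
    by (rule hess_cong) (use kl pos in \<open>auto simp: h[of _ _ "{k, l}"] decr_entry_def\<close>)
  have "hess (h {}) n - hess (?L (h {})) n - hess (?K (h {})) n + hess (?K (?L (h {}))) n \<noteq> 0"
  proof (rule hess_second_difference_nonzero[OF _ _ pos])
    show "degree (h {} i i) = 1 \<and> coeff (h {} i i) 1 = 1" for i
      by (simp add: h_def map_poly_eval01_char_entry)
    show "degree (h {} i a) = 0" if "a < i" for i a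
      using that by (simp add: h_def map_poly_eval01_char_entry)
  qed
  moreover have D: "D S = p n - (\<Sum>s=1..n. if s \<in> S then p (n - s) else 0)" for S
  proof -
    interpret e: comm_ring_hom "eval01 S :: 'a mpol \<Rightarrow> 'a" by (rule comm_ring_hom_eval01)
    interpret ep: map_poly_comm_ring_hom "eval01 S :: 'a mpol \<Rightarrow> 'a" ..
    have "D S = map_poly (eval01 S) (char_poly A)"
      unfolding D_def h_def char_poly_ulh[OF A \<open>ulh A\<close>]
      by (rule hess_hom[symmetric]) (rule ep.comm_ring_hom_axioms)
    also have "\<dots> = p n - (\<Sum>s=1..n. Polynomial.smult (eval01 S (X s)) (p (n - s)))"
      using form A by (simp add: char_poly_form_def ep.hom_minus ep.hom_sum
          e.map_poly_hom_smult map_poly_eval01_Const)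
    also have "(\<Sum>s=1..n. Polynomial.smult (eval01 S (X s)) (p (n - s)))
        = (\<Sum>s=1..n. if s \<in> S then p (n - s) else 0)"
      by (rule sum.cong) (auto simp: eval01_X)
    finally show ?thesis .
  qed
  have "(\<Sum>s=1..n. if s \<in> {k, l} then p (n - s) else 0)
      = (\<Sum>s=1..n. (if s = k then p (n - s) else 0) + (if s = l then p (n - s) else 0))"
    by (rule sum.cong) (use neq in auto)
  then have "D {} - D {l} - D {k} + D {k, l} = 0"
    using kl by (simp add: D sum.distrib)
  ultimately show False
    unfolding Dl Dk Dkl by (simp add: D_def)
qed

section \<open>PB-companion matrices\<close>

lemma pb_companion_const_off_vars:
  assumes A: "A \<in> carrier_mat n n" and pb: "pb_companion A" and vars: "vars_at A r c"
  shows "const_off_vars A r c"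
  unfolding const_off_vars_def
proof (intro ballI impI)
  fix i j assume "i \<in> {1..dim_row A}" "j \<in> {1..dim_row A}"
    and off: "\<forall>k\<in>{1..dim_row A}. (i, j) \<noteq> (r k, c k)"
  then have ij: "i \<in> {1..n}" "j \<in> {1..n}" and off: "\<And>k. k \<in> {1..n} \<Longrightarrow> (i, j) \<noteq> (r k, c k)"
    using A by auto
  have n: "dim_row A = n" using A by simp
  show "entry A i j \<in> range Const"
  proof (rule ccontr)
    assume "entry A i j \<notin> range Const"
    moreover have "entry A i j \<in> range Const \<union> X ` {1..n}"
      using pb ij unfolding pb_companion_def Let_def n by blast
    ultimately obtain k where k: "k \<in> {1..n}" "entry A i j = X k" by auto
    have "\<exists>!(i, j). i \<in> {1..n} \<and> j \<in> {1..n} \<and> entry A i j = X k"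
      using pb k(1) unfolding pb_companion_def Let_def n by blast
    then have "(i, j) = (r k, c k)"
      using ij k vars_atD[OF vars A k(1)] by auto
    then show False using off k(1) by blast
  qed
qed

lemma pb_companion_iff_basis:
  assumes A: "A \<in> carrier_mat n n" and vars: "vars_at A r c" and const: "const_off_vars A r c"
  shows "pb_companion A \<longleftrightarrow> (\<exists>p. is_poly_basis n (p ` {0..n}) \<and> char_poly_form A p)"
proof -
  have n: "dim_row A = n" and sq: "square_mat A" using A by auto
  have ent: "entry A i j \<in> range Const \<or> (\<exists>k\<in>{1..n}. (i, j) = (r k, c k))"
    if "i \<in> {1..n}" "j \<in> {1..n}" for i j
    using const_off_varsD[OF const A that] by blast
  have once: "\<forall>k\<in>{1..n}. \<exists>!(i, j). i \<in> {1..n} \<and> j \<in> {1..n} \<and> entry A i j = X k"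
  proof
    fix k assume k: "k \<in> {1..n}"
    show "\<exists>!(i, j). i \<in> {1..n} \<and> j \<in> {1..n} \<and> entry A i j = X k"
    proof (rule ex1I[of _ "(r k, c k)"])
      fix x assume x: "case x of (i, j) \<Rightarrow> i \<in> {1..n} \<and> j \<in> {1..n} \<and> entry A i j = X k"
      obtain i j where ij: "x = (i, j)" by force
      with x have "entry A i j \<notin> range Const" using X_neq_Const by auto
      then obtain l where l: "l \<in> {1..n}" "(i, j) = (r l, c l)"
        using ent[of i j] x ij by auto
      then have "X l = (X k :: 'a mpol)" using vars_atD(3)[OF vars A l(1)] x ij by simp
      then show "x = (r k, c k)" using l ij by (simp add: X_eq_iff)
    qed (use vars_atD[OF vars A k] in simp)
  qed
  have entries: "\<forall>i\<in>{1..n}. \<forall>j\<in>{1..n}. entry A i j \<in> range Const \<union> X ` {1..n}"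
  proof (intro ballI)
    fix i j assume "i \<in> {1..n}" "j \<in> {1..n}"
    then show "entry A i j \<in> range Const \<union> X ` {1..n}"
      using ent[of i j] vars_atD(3)[OF vars A] by auto
  qed
  show ?thesis
  proof
    assume "pb_companion A"
    then show "\<exists>p. is_poly_basis n (p ` {0..n}) \<and> char_poly_form A p"
      unfolding pb_companion_def Let_def n by (elim conjE)
  next
    assume basis: "\<exists>p. is_poly_basis n (p ` {0..n}) \<and> char_poly_form A p"
    show "pb_companion A"
      unfolding pb_companion_def Let_def n by (intro conjI sq once entries basis)
  qed
qed

theorem theorem15:
  shows "(\<forall>A :: 'a::field mpol mat.
            dim_row A \<ge> 1 \<and> pb_companion A \<and> ulh A \<and> vars_ordered A \<longrightarrow> A \<in> B_tilde) \<and>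
         (\<forall>A :: 'a mpol mat.
            A \<in> B_tilde \<longrightarrow> (pb_companion A \<longleftrightarrow> invertible_mat (coeff_matrix A)))"
proof (intro conjI allI impI)
  fix A :: "'a mpol mat"
  assume asm: "dim_row A \<ge> 1 \<and> pb_companion A \<and> ulh A \<and> vars_ordered A"
  define n where "n = dim_row A"
  have A: "A \<in> carrier_mat n n"
    using asm by (auto simp: n_def ulh_def Let_def)
  obtain r c where vars: "vars_at A r c" and chain: "prec_chain n r c"
    using asm by (auto simp: vars_ordered_def n_def)
  obtain p where form: "char_poly_form A p"
    using asm by (auto simp: pb_companion_def Let_def)
  have const: "const_off_vars A r c"
    using asm by (intro pb_companion_const_off_vars[OF A _ vars]) simp
  show "A \<in> B_tilde"
  proof (rule B_tildeI[OF _ A _ vars chain const])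
    show "c k \<le> r l" if "k \<in> {1..n}" "l \<in> {1..n}" for k l
      using asm that by (intro var_intervals_overlap[OF A _ vars const form]) simp_all
  qed (use asm in \<open>simp_all add: n_def\<close>)
next
  fix A :: "'a mpol mat"
  assume "A \<in> B_tilde"
  then obtain n r c where n: "n \<ge> 1" and A: "A \<in> carrier_mat n n" and ulh: "ulh A"
    and vars: "vars_at A r c" and const: "const_off_vars A r c"
    and le: "\<And>k l. k \<in> {1..n} \<Longrightarrow> l \<in> {1..n} \<Longrightarrow> c k \<le> r l"
    by (rule B_tildeD) blast
  have basis: "is_poly_basis n (p ` {0..n}) \<longleftrightarrow> invertible_mat (coeff_matrix A)"
    if "char_poly_form A p" for p
    using is_poly_basis_iff_invertible[OF char_poly_form_degree[OF A that]]
    by (simp add: coeff_matrix_eq[OF A that])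
  obtain p where "char_poly_form A p"
    using char_poly_form_exists[OF n A ulh vars const le] by blast
  with basis show "pb_companion A \<longleftrightarrow> invertible_mat (coeff_matrix A)"
    unfolding pb_companion_iff_basis[OF A vars const] by blast
qed

end
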